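(* Let $n,m$ be positive integers with $m\ge n$. The following two statements hold. (1) For every $k\in\{1,\dots,m-1\}$, the minimal number of edges of a $k$-resilient bipartite graph $G(n,m)$ is $(k+1)n$; likewise, the minimal number of edges of a strongly $k$-resilient bipartite graph $G(n,m)$ is $(k+1)n$. (2) The maximal degree of resilience of a bipartite graph $G(n,m)$ (over all bipartite graphs with $n$ left-nodes and $m$ right-nodes) is $m-1$; likewise, the maximal degree of strong resilience of a bipartite graph $G(n,m)$ is $m-1$.
   Context: A sparsity pattern $\mathcal S=\mathcal S(n,m)$ in $\mathbb R^{n\times m}$ is a vector subspace admitting a basis consisting only of matrices $E_{ij}$ ($1$ in entry $(i,j)$, $0$ elsewhere). $E(\mathcal S)$ is the set of pairs $(i,j)$ with $E_{ij}\in\mathcal S$. The rank $\operatorname{rk}\mathcal S$ is the maximal rank of the matrices in $\mathcal S$. Write $\mathcal S'\prec\mathcal S$ if $E(\mathcal S')\subsetneq E(\mathcal S)$ (patterns of the same size). Resilience: for $m\ge n$, a pattern $\mathcal S(n,m)$ of rank $n$ is (exactly) $k$-resilient, $0\le k\le|E(\mathcal S)|$, if (i) all patterns $\mathcal S'\prec\mathcal S$ with $|E(\mathcal S')|\ge|E(\mathcal S)|-k$ have rank $n$; and (ii) there exists $\mathcal S'\prec\mathcal S$ with $|E(\mathcal S')|=|E(\mathcal S)|-k-1$ whose rank is less than $n$. The integer $k$ is the degree of resilience of $\mathcal S$. Strong resilience: a pattern $\mathcal S(n,m)$ of rank $n$ is (exactly) strongly $k$-resilient, $k\ge0$, if it contains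 a direct sum of $k+1$, but not of $k+2$, sparsity patterns each of which is $0$-resilient (direct sum meaning the patterns have pairwise disjoint index sets). The integer $k$ is the degree of strong resilience of $\mathcal S$. By convention both degrees equal $-1$ if $\operatorname{rk}\mathcal S<n$. The pattern $\mathcal S(n,m)$ corresponds bijectively to the undirected bipartite graph $G(n,m)=(V_\alpha\cup V_\beta,E)$ with left-nodes $\alpha_1,\dots,\alpha_n$, right-nodes $\beta_1,\dots,\beta_m$, and $(\alpha_i,\beta_j)\in E$ iff $(i,j)\in E(\mathcal S)$. Resilience notions and degrees for $G$ are those of the corresponding pattern; $k$-resilient and strongly $k$-resilient always refer to the exact degree. *)

theory Defs
  imports "HOL-Analysis.Analysis"
begin

text \<open>
  The dimensions \<open>n\<close> and \<open>m\<close> are the cardinalities of the finite index types \<open>'n\<close> and \<open>'m\<close>;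
  real \<open>n \<times> m\<close> matrices have type \<^typ>\<open>real^'m^'n\<close> (row index \<open>'n\<close>, column index \<open>'m\<close>).
\<close>

definition matrix_unit :: "'n::finite \<Rightarrow> 'm::finite \<Rightarrow> real^'m^'n" where
  "matrix_unit i j = axis i (axis j 1)"

definition sparsity_pattern :: "(real^'m::finite^'n::finite) set \<Rightarrow> bool" where
  "sparsity_pattern S \<longleftrightarrow> subspace S \<and>
     (\<exists>B. B \<subseteq> {matrix_unit i j |i j. True} \<and> independent B \<and> span B = S)"

definition pattern_index :: "(real^'m::finite^'n::finite) set \<Rightarrow> ('n \<times> 'm) set" where
  "pattern_index S = {(i, j). matrix_unit i j \<in> S}"

text \<open>Matrix ranks are bounded, so the maximum below ranges over a finite set, nonempty for a subspace.\<close>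

definition pattern_rank :: "(real^'m::finite^'n::finite) set \<Rightarrow> nat" where
  "pattern_rank S = Max (rank ` S)"

definition pattern_less ::
  "(real^'m::finite^'n::finite) set \<Rightarrow> (real^'m^'n) set \<Rightarrow> bool" where
  "pattern_less S' S \<longleftrightarrow> pattern_index S' \<subset> pattern_index S"

text \<open>Cardinality conditions are written additively to avoid truncated subtraction.\<close>

definition resilient :: "nat \<Rightarrow> (real^'m::finite^'n::finite) set \<Rightarrow> bool" where
  "resilient k S \<longleftrightarrow>
     sparsity_pattern S \<and> pattern_rank S = CARD('n) \<and> k \<le> card (pattern_index S) \<and>
     (\<forall>S'. sparsity_pattern S' \<and> pattern_less S' S \<and> card (pattern_index S') + k \<ge> card (pattern_index S)
        \<longrightarrow> pattern_rank S' = CARD('n)) \<and>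
     (\<exists>S'. sparsity_pattern S' \<and> pattern_less S' S \<and> card (pattern_index S') + k + 1 = card (pattern_index S)
        \<and> pattern_rank S' < CARD('n))"

text \<open>The sum of finitely many subspaces is the span of their union.\<close>

definition contains_direct_sum :: "nat \<Rightarrow> (real^'m::finite^'n::finite) set \<Rightarrow> bool" where
  "contains_direct_sum r S \<longleftrightarrow>
     (\<exists>T :: nat \<Rightarrow> (real^'m^'n) set.
        (\<forall>l<r. sparsity_pattern (T l) \<and> resilient 0 (T l)) \<and>
        disjoint_family_on (\<lambda>l. pattern_index (T l)) {..<r} \<and>
        span (\<Union>l<r. T l) \<subseteq> S)"

definition strongly_resilient :: "nat \<Rightarrow> (real^'m::finite^'n::finite) set \<Rightarrow> bool" where
  "strongly_resilient k S \<longleftrightarrow>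
     sparsity_pattern S \<and> pattern_rank S = CARD('n) \<and>
     contains_direct_sum (k + 1) S \<and> \<not> contains_direct_sum (k + 2) S"

definition resilience_degree :: "(real^'m::finite^'n::finite) set \<Rightarrow> int" where
  "resilience_degree S =
     (if pattern_rank S < CARD('n) then - 1 else int (THE k. resilient k S))"

definition strong_resilience_degree :: "(real^'m::finite^'n::finite) set \<Rightarrow> int" where
  "strong_resilience_degree S =
     (if pattern_rank S < CARD('n) then - 1 else int (THE k. strongly_resilient k S))"

text \<open>
  A bipartite graph on the left-nodes \<open>Inl i\<close> and the right-nodes \<open>Inr j\<close> is given by its set
  of undirected edges; the node set is all of \<^typ>\<open>'n + 'm\<close>.
\<close>

definition bipartite_graph :: "('n::finite + 'm::finite) set set \<Rightarrow> bool" where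
  "bipartite_graph G \<longleftrightarrow> G \<subseteq> {{Inl i, Inr j} |i j. True}"

definition graph_pattern :: "('n::finite + 'm::finite) set set \<Rightarrow> (real^'m^'n) set" where
  "graph_pattern G = span {matrix_unit i j |i j. {Inl i, Inr j} \<in> G}"

definition graph_resilient :: "nat \<Rightarrow> ('n::finite + 'm::finite) set set \<Rightarrow> bool" where
  "graph_resilient k G \<longleftrightarrow> resilient k (graph_pattern G)"

definition graph_strongly_resilient :: "nat \<Rightarrow> ('n::finite + 'm::finite) set set \<Rightarrow> bool" where
  "graph_strongly_resilient k G \<longleftrightarrow> strongly_resilient k (graph_pattern G)"

definition graph_resilience_degree :: "('n::finite + 'm::finite) set set \<Rightarrow> int" where
  "graph_resilience_degree G = resilience_degree (graph_pattern G)"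

definition graph_strong_resilience_degree :: "('n::finite + 'm::finite) set set \<Rightarrow> int" where
  "graph_strong_resilience_degree G = strong_resilience_degree (graph_pattern G)"

definition is_minimum :: "'a::order \<Rightarrow> 'a set \<Rightarrow> bool" where
  "is_minimum x A \<longleftrightarrow> x \<in> A \<and> (\<forall>y\<in>A. x \<le> y)"

definition is_maximum :: "'a::order \<Rightarrow> 'a set \<Rightarrow> bool" where
  "is_maximum x A \<longleftrightarrow> x \<in> A \<and> (\<forall>y\<in>A. y \<le> x)"

end

theory Submission
  imports Defs
begin

text \<open>
  Everything reduces to the index set \<open>E\<close> of a pattern, and only three facts about ranks are
  used: full rank is inherited by larger index sets (\<open>full_rank_mono\<close>), an index set of full
  rank meets every row (\<open>full_rank_row_nonempty\<close>), and the graph of an injection from rows to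
  columns has full rank (\<open>full_rank_matching\<close>).

  For the lower bounds on the number of edges, note that deleting all the edges at a left-node
  destroys full rank. A \<open>k\<close>-resilient graph therefore has at least \<open>k + 1\<close> edges at each
  left-node, hence at least \<open>(k + 1) n\<close> edges; as a left-node has at most \<open>m\<close> edges, also
  \<open>k + 1 \<le> m\<close>. For strong resilience each of the \<open>k + 1\<close> disjoint summands has full rank and so
  at least \<open>n\<close> edges; comparing \<open>(k + 1) n\<close> with the number \<open>n m\<close> of all possible edges gives
  \<open>k + 1 \<le> m\<close> again.

  For the converse, number rows and columns and let the \<open>l\<close>-th matching send row \<open>i\<close> to
  column \<open>i + l\<close> modulo \<open>m\<close>. For \<open>l < m\<close> these matchings are pairwise disjoint, and the union of
  \<open>k + 1\<close> of them attains the bounds for both notions: any \<open>k\<close> deletions spare one of the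
  matchings, and each matching is a \<open>0\<close>-resilient summand. With \<open>k = m - 1\<close> this gives the
  maximal degrees.

  The degrees are defined by definite description, so it also has to be shown that each pattern
  of full rank has exactly one degree of each kind (\<open>ex1_resilient\<close>,
  \<open>ex1_strongly_resilient\<close>).
\<close>

section \<open>Patterns and their index sets\<close>

definition pattern_of :: "('n::finite \<times> 'm::finite) set \<Rightarrow> (real^'m^'n) set" where
  "pattern_of E = span {matrix_unit i j |i j. (i, j) \<in> E}"

lemma matrix_unit_nth: "matrix_unit i j $ a $ b = (if a = i \<and> b = j then 1 else 0)"
  by (simp add: matrix_unit_def axis_def)

lemma matrix_eq_sum_matrix_units:
  fixes A :: "real^'m::finite^'n::finite"
  shows "A = (\<Sum>i\<in>UNIV. \<Sum>j\<in>UNIV. (A $ i $ j) *\<^sub>R matrix_unit i j)"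
proof -
  have "(\<Sum>i\<in>UNIV. \<Sum>j\<in>UNIV. (A $ i $ j) *\<^sub>R matrix_unit i j) $ a $ b = A $ a $ b" for a b
  proof -
    have "(\<Sum>i\<in>UNIV. \<Sum>j\<in>UNIV. (A $ i $ j) *\<^sub>R matrix_unit i j) $ a $ b
      = (\<Sum>i\<in>UNIV. if a = i then (\<Sum>j\<in>UNIV. if b = j then A $ i $ j else 0) else 0)"
      unfolding sum_component vector_scaleR_component
      by (rule sum.cong) (auto simp: matrix_unit_nth if_distrib[of "\<lambda>a. _ * a"] cong: if_cong)
    then show ?thesis
      by simp
  qed
  then show ?thesis
    by (simp add: vec_eq_iff)
qed

lemma in_pattern_of_iff: "A \<in> pattern_of E \<longleftrightarrow> (\<forall>i j. (i, j) \<notin> E \<longrightarrow> A $ i $ j = 0)"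
proof
  assume "A \<in> pattern_of E"
  then show "\<forall>i j. (i, j) \<notin> E \<longrightarrow> A $ i $ j = 0"
    unfolding pattern_of_def
  proof (induction rule: span_induct)
    case base
    show ?case
      by (auto simp: subspace_def)
  next
    case (step A)
    then show ?case
      by (auto simp: matrix_unit_nth)
  qed
next
  assume A: "\<forall>i j. (i, j) \<notin> E \<longrightarrow> A $ i $ j = 0"
  have "(A $ i $ j) *\<^sub>R matrix_unit i j \<in> pattern_of E" for i j
  proof (cases "(i, j) \<in> E")
    case True
    then show ?thesis
      unfolding pattern_of_def by (intro span_scale span_base) blast
  next
    case False
    then show ?thesis
      using A by (simp add: pattern_of_def span_zero)
  qed
  then have "(\<Sum>i\<in>UNIV. \<Sum>j\<in>UNIV. (A $ i $ j) *\<^sub>R matrix_unit i j) \<in> pattern_of E"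
    unfolding pattern_of_def by (intro span_sum)
  then show "A \<in> pattern_of E"
    by (simp only: matrix_eq_sum_matrix_units[symmetric])
qed

lemma subspace_pattern_of: "subspace (pattern_of E)"
  by (simp add: pattern_of_def)

lemma pattern_index_pattern_of [simp]: "pattern_index (pattern_of E) = E"
  by (auto simp: pattern_index_def in_pattern_of_iff matrix_unit_nth)

lemma pattern_of_mono: "E \<subseteq> F \<Longrightarrow> pattern_of E \<subseteq> pattern_of F"
  by (fastforce simp: in_pattern_of_iff)

lemma sparsity_pattern_pattern_of [simp]: "sparsity_pattern (pattern_of E)"
proof -
  obtain B where B: "B \<subseteq> {matrix_unit i j |i j. (i, j) \<in> E}" "independent B"
      "{matrix_unit i j |i j. (i, j) \<in> E} \<subseteq> span B"
    by (rule maximal_independent_subset)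
  have "span B = pattern_of E"
    unfolding pattern_of_def by (intro subset_antisym span_mono span_minimal subspace_span B)
  then show ?thesis
    unfolding sparsity_pattern_def using B subspace_pattern_of by blast
qed

lemma sparsity_pattern_eq_pattern_of:
  assumes "sparsity_pattern S"
  shows "S = pattern_of (pattern_index S)"
proof
  obtain B where B: "B \<subseteq> {matrix_unit i j |i j. True}" "span B = S" and S: "subspace S"
    using assms unfolding sparsity_pattern_def by blast
  have "B \<subseteq> {matrix_unit i j |i j. (i, j) \<in> pattern_index S}"
    using B span_superset[of B] unfolding pattern_index_def by blast
  then show "S \<subseteq> pattern_of (pattern_index S)"
    unfolding pattern_of_def using B(2) span_mono by blast
  show "pattern_of (pattern_index S) \<subseteq> S"
    unfolding pattern_of_def using S by (intro span_minimal) (auto simp: pattern_index_def)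
qed

lemma all_sparsity_pattern_iff:
  "(\<forall>S. sparsity_pattern S \<longrightarrow> P S) \<longleftrightarrow> (\<forall>E. P (pattern_of E))"
  by (metis sparsity_pattern_eq_pattern_of sparsity_pattern_pattern_of)

lemma ex_sparsity_pattern_iff:
  "(\<exists>S. sparsity_pattern S \<and> P S) \<longleftrightarrow> (\<exists>E. P (pattern_of E))"
  by (metis sparsity_pattern_eq_pattern_of sparsity_pattern_pattern_of)

section \<open>Full rank\<close>

definition full_rank :: "('n::finite \<times> 'm::finite) set \<Rightarrow> bool" where
  "full_rank E \<longleftrightarrow> (\<exists>A\<in>pattern_of E. rank A = CARD('n))"

lemma finite_ranks: "finite (rank ` (S :: (real^'m::finite^'n::finite) set))"
  by (rule finite_subset[of _ "{..CARD('n)}"])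
    (use rank_bound in \<open>force simp: min_def split: if_splits\<close>)+

lemma pattern_rank_le: "pattern_rank (pattern_of (E :: ('n::finite \<times> 'm::finite) set)) \<le> CARD('n)"
proof -
  have "pattern_of E \<noteq> {}"
    using subspace_0[OF subspace_pattern_of] by blast
  moreover have "rank A \<le> CARD('n)" for A :: "real^'m^'n"
    using rank_bound[of A] by simp
  ultimately show ?thesis
    unfolding pattern_rank_def using finite_ranks by (subst Max_le_iff) auto
qed

lemma pattern_rank_eq_iff:
  fixes E :: "('n::finite \<times> 'm::finite) set"
  shows "pattern_rank (pattern_of E) = CARD('n) \<longleftrightarrow> full_rank E"
proof
  have "pattern_of E \<noteq> {}"
    using subspace_0[OF subspace_pattern_of] by blast
  then have "pattern_rank (pattern_of E) \<in> rank ` pattern_of E"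
    unfolding pattern_rank_def using finite_ranks by (intro Max_in) auto
  then show "pattern_rank (pattern_of E) = CARD('n) \<Longrightarrow> full_rank E"
    by (auto simp: full_rank_def)
  show "full_rank E \<Longrightarrow> pattern_rank (pattern_of E) = CARD('n)"
    using pattern_rank_le[of E] finite_ranks[of "pattern_of E"]
    unfolding full_rank_def pattern_rank_def by (metis Max_ge antisym imageI)
qed

lemma pattern_rank_less_iff:
  fixes E :: "('n::finite \<times> 'm::finite) set"
  shows "pattern_rank (pattern_of E) < CARD('n) \<longleftrightarrow> \<not> full_rank E"
  using pattern_rank_le[of E] pattern_rank_eq_iff[of E] by linarith

lemma full_rank_mono: "full_rank E \<Longrightarrow> E \<subseteq> F \<Longrightarrow> full_rank F"
  unfolding full_rank_def using pattern_of_mono by blast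

text \<open>
  A matrix whose row \<open>i\<close> vanishes misses the \<open>i\<close>-th unit vector in its image. This is the only
  obstruction to full rank on which the lower bounds rely.
\<close>

lemma full_rank_row_nonempty:
  fixes E :: "('n::finite \<times> 'm::finite) set"
  assumes "full_rank E"
  obtains j where "(i, j) \<in> E"
proof -
  obtain A :: "real^'m^'n" where A: "A \<in> pattern_of E" "rank A = CARD('n)"
    using assms by (auto simp: full_rank_def)
  obtain x where x: "A *v x = axis i 1"
    using A(2) full_rank_surjective[of A] by (metis surjD)
  have "\<exists>j. A $ i $ j \<noteq> 0"
  proof (rule ccontr)
    assume "\<not> ?thesis"
    then have "(A *v x) $ i = 0"
      by (simp add: matrix_vector_mult_def)
    then show False
      by (simp add: x axis_def)
  qed
  then show thesis
    using A(1) that by (auto simp: in_pattern_of_iff)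
qed

text \<open>
  The 0-1 matrix supported on the matching sends \<open>x\<close> to the vector of the \<open>x (f i)\<close>, so every
  vector is attained by reading it back along \<open>f\<close>.
\<close>

lemma full_rank_matching:
  fixes f :: "'n::finite \<Rightarrow> 'm::finite"
  assumes "inj f"
  shows "full_rank (range (\<lambda>i. (i, f i)))"
proof -
  define A :: "real^'m^'n" where "A = (\<chi> i j. if j = f i then 1 else 0)"
  have A_mult: "(A *v x) $ i = x $ f i" for x i
    by (simp add: A_def matrix_vector_mult_def if_distrib[of "\<lambda>a. a * _"] cong: if_cong)
  have "\<exists>x. y = A *v x" for y
  proof
    show "y = A *v (\<chi> j. y $ inv f j)"
      using assms by (simp add: vec_eq_iff A_mult)
  qed
  then have "rank A = CARD('n)"
    unfolding full_rank_surjective by (auto simp: surj_def)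
  moreover have "A \<in> pattern_of (range (\<lambda>i. (i, f i)))"
    by (auto simp: in_pattern_of_iff A_def)
  ultimately show ?thesis
    by (auto simp: full_rank_def)
qed

lemma card_eq_sum_rows:
  fixes E :: "('n::finite \<times> 'm::finite) set"
  shows "card E = (\<Sum>i\<in>UNIV. card {j. (i, j) \<in> E})"
proof -
  have "E = Sigma UNIV (\<lambda>i. {j. (i, j) \<in> E})"
    by auto
  then have "card E = card (Sigma UNIV (\<lambda>i. {j. (i, j) \<in> E}))"
    by (rule arg_cong)
  also have "\<dots> = (\<Sum>i\<in>UNIV. card {j. (i, j) \<in> E})"
    by (rule card_SigmaI) auto
  finally show ?thesis .
qed

lemma card_ge_if_rows_ge:
  fixes E :: "('n::finite \<times> 'm::finite) set"
  assumes "\<And>i. r \<le> card {j. (i, j) \<in> E}"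
  shows "r * CARD('n) \<le> card E"
  using sum_bounded_below[of "UNIV :: 'n set" r "\<lambda>i. card {j. (i, j) \<in> E}"] assms
  by (simp add: card_eq_sum_rows mult.commute)

lemma full_rank_card_ge:
  fixes E :: "('n::finite \<times> 'm::finite) set"
  assumes "full_rank E"
  shows "CARD('n) \<le> card E"
proof -
  have "1 \<le> card {j. (i, j) \<in> E}" for i
    using full_rank_row_nonempty[OF assms, of i] by (auto simp: Suc_le_eq card_gt_0_iff)
  then show ?thesis
    using card_ge_if_rows_ge[of 1 E] by simp
qed

lemma not_full_rank_empty: "\<not> full_rank {}"
  using full_rank_row_nonempty by fastforce

section \<open>Resilience\<close>

text \<open>
  A sparsity pattern is determined by its index set, so resilience becomes a statement about
  deleting elements from a finite set.
\<close>

lemma resilient_pattern_of_iff: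
  fixes E :: "('n::finite \<times> 'm::finite) set"
  shows "resilient k (pattern_of E) \<longleftrightarrow>
     full_rank E \<and> k \<le> card E \<and>
     (\<forall>E'. E' \<subset> E \<and> card E \<le> card E' + k \<longrightarrow> full_rank E') \<and>
     (\<exists>E'. E' \<subset> E \<and> card E' + k + 1 = card E \<and> \<not> full_rank E')"
proof -
  have "(\<forall>S'. sparsity_pattern S' \<and> pattern_less S' (pattern_of E) \<and>
            card (pattern_index S') + k \<ge> card (pattern_index (pattern_of E))
          \<longrightarrow> pattern_rank S' = CARD('n)) \<longleftrightarrow>
        (\<forall>E'. E' \<subset> E \<and> card E \<le> card E' + k \<longrightarrow> full_rank E')"
    using all_sparsity_pattern_iff[of "\<lambda>S'. pattern_less S' (pattern_of E) \<and>
            card (pattern_index S') + k \<ge> card (pattern_index (pattern_of E))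
          \<longrightarrow> pattern_rank S' = CARD('n)"]
    by (simp add: pattern_less_def pattern_rank_eq_iff imp_conjL)
  moreover have "(\<exists>S'. sparsity_pattern S' \<and> pattern_less S' (pattern_of E) \<and>
            card (pattern_index S') + k + 1 = card (pattern_index (pattern_of E)) \<and>
            pattern_rank S' < CARD('n)) \<longleftrightarrow>
        (\<exists>E'. E' \<subset> E \<and> card E' + k + 1 = card E \<and> \<not> full_rank E')"
    by (subst ex_sparsity_pattern_iff) (simp add: pattern_less_def pattern_rank_less_iff)
  ultimately show ?thesis
    unfolding resilient_def by (simp add: pattern_rank_eq_iff)
qed

text \<open>
  If some row had at most \<open>k\<close> entries, emptying it would be an admissible deletion. The deletion
  is a proper one because full rank leaves no row empty from the start.
\<close>

lemma resilient_row_card: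
  fixes E :: "('n::finite \<times> 'm::finite) set"
  assumes "resilient k (pattern_of E)"
  shows "k + 1 \<le> card {j. (i, j) \<in> E}"
proof (rule ccontr)
  let ?R = "{i} \<times> {j. (i, j) \<in> E}"
  assume "\<not> ?thesis"
  then have "card ?R \<le> k"
    by (simp add: card_cartesian_product)
  then have "card E \<le> card (E - ?R) + k"
    using card_Diff_subset[of ?R E] by force
  moreover have "full_rank E"
    using assms by (simp add: resilient_pattern_of_iff)
  then obtain j where "(i, j) \<in> E"
    using full_rank_row_nonempty by blast
  then have "E - ?R \<subset> E"
    by blast
  ultimately have "full_rank (E - ?R)"
    using assms by (simp add: resilient_pattern_of_iff)
  then show False
    using full_rank_row_nonempty[of "E - ?R" i] by blast
qed

lemma resilient_card_ge:
  fixes E :: "('n::finite \<times> 'm::finite) set"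
  assumes "resilient k (pattern_of E)"
  shows "(k + 1) * CARD('n) \<le> card E"
  using card_ge_if_rows_ge resilient_row_card[OF assms] by blast

lemma resilient_less_card:
  fixes E :: "('n::finite \<times> 'm::finite) set"
  assumes "resilient k (pattern_of E)"
  shows "k < CARD('m)"
proof -
  have "card {j. (i, j) \<in> E} \<le> CARD('m)" for i :: 'n
    by (intro card_mono) auto
  then show ?thesis
    using resilient_row_card[OF assms] by (metis Suc_eq_plus1 Suc_le_eq le_trans)
qed

text \<open>
  A set that is minimal for full rank loses it with any one edge. This supplies the summands
  needed for strong resilience, inside a given pattern as well as in the extremal example.
\<close>

lemma resilient_0_if_minimal:
  assumes "full_rank F" and "\<And>F'. F' \<subset> F \<Longrightarrow> \<not> full_rank F'"
  shows "resilient 0 (pattern_of F)"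
proof -
  have "F \<noteq> {}"
    using assms(1) not_full_rank_empty by auto
  then obtain e where "e \<in> F"
    by blast
  then have "F - {e} \<subset> F" "card (F - {e}) + 0 + 1 = card F"
    using card.remove[of F e] by auto
  moreover have "card F' < card F" if "F' \<subset> F" for F'
    using that by (intro psubset_card_mono) auto
  ultimately show ?thesis
    unfolding resilient_pattern_of_iff using assms(1) assms(2) by (metis add_0_right le0 not_less)
qed

text \<open>
  The degree is one less than the least number of deletions that destroy full rank; deleting
  all the edges does destroy it, so such a number exists.
\<close>

lemma ex1_resilient:
  assumes "full_rank E"
  shows "\<exists>!k. resilient k (pattern_of E)"
proof -
  define bad where "bad k \<longleftrightarrow> (\<exists>E'. E' \<subset> E \<and> card E' + k + 1 = card E \<and> \<not> full_rank E')" for k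
  define k where "k = (LEAST k. bad k)"
  have "E \<noteq> {}"
    using assms not_full_rank_empty by auto
  then have "bad (card E - 1)"
    unfolding bad_def
    using not_full_rank_empty by (intro exI[of _ "{}"]) (auto simp: card_gt_0_iff Suc_le_eq)
  then have k: "bad k"
    unfolding k_def by (rule LeastI)
  have "full_rank E'" if "E' \<subset> E" "card E \<le> card E' + k" for E'
  proof (rule ccontr)
    assume "\<not> full_rank E'"
    moreover have "card E' < card E"
      using that(1) by (simp add: psubset_card_mono)
    ultimately have "bad (card E - card E' - 1)"
      unfolding bad_def using that(1) by (intro exI[of _ E']) auto
    then have "k \<le> card E - card E' - 1"
      unfolding k_def by (rule Least_le)
    then show False
      using that(2) \<open>card E' < card E\<close> by linarith
  qed
  then have ex: "resilient k (pattern_of E)"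
    using k assms unfolding resilient_pattern_of_iff bad_def by auto
  have "\<not> k < l" if "resilient k (pattern_of E)" "resilient l (pattern_of E)" for k l
  proof
    assume "k < l"
    have "bad k"
      using that(1) unfolding resilient_pattern_of_iff bad_def by (elim conjE)
    then obtain E' where "E' \<subset> E" "card E' + k + 1 = card E" "\<not> full_rank E'"
      unfolding bad_def by blast
    moreover from this have "full_rank E'"
      using that(2) \<open>k < l\<close> by (simp add: resilient_pattern_of_iff)
    ultimately show False
      by blast
  qed
  then show ?thesis
    using ex by (metis nat_neq_iff)
qed

lemma resilience_degree_eq:
  assumes "resilient k (pattern_of E)"
  shows "resilience_degree (pattern_of E) = int k"
proof -
  have full: "full_rank E"
    using assms by (simp add: resilient_pattern_of_iff)
  have "(THE k. resilient k (pattern_of E)) = k"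
    using ex1_resilient[OF full] assms by (rule the1_equality)
  then show ?thesis
    using full by (simp add: resilience_degree_def pattern_rank_less_iff)
qed

lemma resilience_degree_le:
  fixes E :: "('n::finite \<times> 'm::finite) set"
  shows "resilience_degree (pattern_of E) \<le> int CARD('m) - 1"
proof (cases "full_rank E")
  case True
  then obtain k where k: "resilient k (pattern_of E)"
    using ex1_resilient by blast
  then show ?thesis
    using resilience_degree_eq[OF k] resilient_less_card[OF k] by simp
next
  case False
  then show ?thesis
    by (simp add: resilience_degree_def pattern_rank_less_iff)
qed

section \<open>Strong resilience\<close>

lemma contains_direct_sum_antimono:
  assumes "contains_direct_sum r S" "q \<le> r"
  shows "contains_direct_sum q S"
proof -
  obtain T where T: "\<forall>l<r. sparsity_pattern (T l) \<and> resilient 0 (T l)"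
      "disjoint_family_on (\<lambda>l. pattern_index (T l)) {..<r}" "span (\<Union>l<r. T l) \<subseteq> S"
    using assms(1) unfolding contains_direct_sum_def by blast
  have "span (\<Union>l<q. T l) \<subseteq> span (\<Union>l<r. T l)"
    using assms(2) by (intro span_mono) force
  moreover have "disjoint_family_on (\<lambda>l. pattern_index (T l)) {..<q}"
    using T(2) assms(2) by (auto simp: disjoint_family_on_def)
  ultimately show ?thesis
    unfolding contains_direct_sum_def using T assms(2) by (intro exI[of _ T]) auto
qed

text \<open>Each of the disjoint summands has full rank and so at least one entry in every row.\<close>

lemma contains_direct_sum_card_ge:
  fixes E :: "('n::finite \<times> 'm::finite) set"
  assumes "contains_direct_sum r (pattern_of E)"
  shows "r * CARD('n) \<le> card E"
proof -
  obtain T :: "nat \<Rightarrow> (real^'m^'n) set"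
    where T: "\<And>l. l < r \<Longrightarrow> sparsity_pattern (T l) \<and> resilient 0 (T l)"
      "disjoint_family_on (\<lambda>l. pattern_index (T l)) {..<r}"
      "span (\<Union>l<r. T l) \<subseteq> pattern_of E"
    using assms unfolding contains_direct_sum_def by blast
  have le: "CARD('n) \<le> card (pattern_index (T l))" if "l < r" for l
  proof (rule full_rank_card_ge)
    show "full_rank (pattern_index (T l))"
      using T(1)[OF that] sparsity_pattern_eq_pattern_of resilient_pattern_of_iff by metis
  qed
  have sub: "pattern_index (T l) \<subseteq> E" if "l < r" for l
  proof -
    have "T l \<subseteq> pattern_of E"
      using that T(3) span_superset[of "\<Union>l<r. T l"] by blast
    then have "pattern_index (T l) \<subseteq> pattern_index (pattern_of E)"
      by (auto simp: pattern_index_def)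
    then show ?thesis
      by simp
  qed
  have "r * CARD('n) \<le> (\<Sum>l<r. card (pattern_index (T l)))"
    using sum_bounded_below[of "{..<r}" "CARD('n)" "\<lambda>l. card (pattern_index (T l))"] le by simp
  also have "\<dots> = card (\<Union>l<r. pattern_index (T l))"
    using T(2) by (intro card_UN_disjoint[symmetric]) (auto simp: disjoint_family_on_def)
  also have "\<dots> \<le> card E"
    using sub by (intro card_mono) auto
  finally show ?thesis .
qed

lemma contains_direct_sum_le_card:
  fixes E :: "('n::finite \<times> 'm::finite) set"
  assumes "contains_direct_sum r (pattern_of E)"
  shows "r \<le> CARD('m)"
proof -
  have "r * CARD('n) \<le> card E"
    using assms by (rule contains_direct_sum_card_ge)
  also have "\<dots> \<le> CARD('n \<times> 'm)"
    by (intro card_mono) auto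
  finally have "r * CARD('n) \<le> CARD('n) * CARD('m)"
    by simp
  then show ?thesis
    by (simp add: mult.commute)
qed

text \<open>The summand is a subset of \<open>E\<close> that is minimal for full rank.\<close>

lemma contains_direct_sum_1:
  assumes "full_rank E"
  shows "contains_direct_sum 1 (pattern_of E)"
proof -
  obtain F where F: "F \<subseteq> E" "full_rank F" and min: "\<And>F'. F' \<subset> F \<Longrightarrow> \<not> full_rank F'"
  proof -
    obtain F where "F \<in> {F. F \<subseteq> E \<and> full_rank F}"
      "\<And>F'. F' \<in> {F. F \<subseteq> E \<and> full_rank F} \<Longrightarrow> F' \<subseteq> F \<Longrightarrow> F = F'"
      using finite_has_minimal[of "{F. F \<subseteq> E \<and> full_rank F}"] assms by auto
    then show thesis
      using that[of F] by blast
  qed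
  have "resilient 0 (pattern_of F)"
    using F(2) min by (rule resilient_0_if_minimal)
  moreover have "span (\<Union>l<(1::nat). pattern_of F) \<subseteq> pattern_of E"
    by (intro span_minimal subspace_pattern_of UN_least pattern_of_mono F(1))
  ultimately show ?thesis
    unfolding contains_direct_sum_def
    by (intro exI[of _ "\<lambda>_. pattern_of F"]) (auto simp: disjoint_family_on_def)
qed

lemma strongly_resilient_pattern_of_iff:
  "strongly_resilient k (pattern_of E) \<longleftrightarrow> full_rank E \<and>
     contains_direct_sum (k + 1) (pattern_of E) \<and> \<not> contains_direct_sum (k + 2) (pattern_of E)"
  by (simp add: strongly_resilient_def pattern_rank_eq_iff)

text \<open>
  The admissible numbers of summands are bounded and closed downwards, so the degree is one less
  than the greatest of them; this number is at least 1 by \<open>contains_direct_sum_1\<close>.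
\<close>

lemma ex1_strongly_resilient:
  fixes E :: "('n::finite \<times> 'm::finite) set"
  assumes "full_rank E"
  shows "\<exists>!k. strongly_resilient k (pattern_of E)"
proof -
  define k where "k = (GREATEST k. contains_direct_sum (k + 1) (pattern_of E))"
  have bound: "k \<le> CARD('m)" if "contains_direct_sum (k + 1) (pattern_of E)" for k
    using contains_direct_sum_le_card[OF that] by simp
  have 0: "contains_direct_sum (0 + 1) (pattern_of E)"
    using contains_direct_sum_1[OF assms] by simp
  have k: "contains_direct_sum (k + 1) (pattern_of E)"
    unfolding k_def
    using GreatestI_nat[of "\<lambda>k. contains_direct_sum (k + 1) (pattern_of E)", OF 0] bound by blast
  have "\<not> contains_direct_sum (Suc k + 1) (pattern_of E)"
    unfolding k_def
    using Greatest_le_nat[of "\<lambda>k. contains_direct_sum (k + 1) (pattern_of E)"] bound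
    by (metis Suc_n_not_le_n)
  then have ex: "strongly_resilient k (pattern_of E)"
    using k assms by (simp add: strongly_resilient_pattern_of_iff)
  have "\<not> k < l" if "strongly_resilient k (pattern_of E)" "strongly_resilient l (pattern_of E)" for k l
    using that contains_direct_sum_antimono[of "l + 1" "pattern_of E" "k + 2"]
    by (auto simp: strongly_resilient_pattern_of_iff)
  then show ?thesis
    using ex by (metis nat_neq_iff)
qed

lemma strong_resilience_degree_eq:
  assumes "strongly_resilient k (pattern_of E)"
  shows "strong_resilience_degree (pattern_of E) = int k"
proof -
  have full: "full_rank E"
    using assms by (simp add: strongly_resilient_pattern_of_iff)
  have "(THE k. strongly_resilient k (pattern_of E)) = k"
    using ex1_strongly_resilient[OF full] assms by (rule the1_equality)
  then show ?thesis
    using full by (simp add: strong_resilience_degree_def pattern_rank_less_iff)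
qed

lemma strong_resilience_degree_le:
  fixes E :: "('n::finite \<times> 'm::finite) set"
  shows "strong_resilience_degree (pattern_of E) \<le> int CARD('m) - 1"
proof (cases "full_rank E")
  case True
  then obtain k where k: "strongly_resilient k (pattern_of E)"
    using ex1_strongly_resilient by blast
  then have "k + 1 \<le> CARD('m)"
    using contains_direct_sum_le_card strongly_resilient_pattern_of_iff by blast
  then show ?thesis
    using strong_resilience_degree_eq[OF k] by simp
next
  case False
  then show ?thesis
    by (simp add: strong_resilience_degree_def pattern_rank_less_iff)
qed

section \<open>Unions of disjoint matchings\<close>

definition matching_union :: "(nat \<Rightarrow> 'n::finite \<Rightarrow> 'm::finite) \<Rightarrow> nat \<Rightarrow> ('n \<times> 'm) set" where
  "matching_union f r = (\<Union>l<r. range (\<lambda>i. (i, f l i)))"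

lemma mod_add_left_inj:
  fixes a b c m :: nat
  assumes "(a + b) mod m = (a + c) mod m" "b < m" "c < m"
  shows "b = c"
proof -
  have "b mod m = c mod m"
    using assms(1) unfolding nat_mod_eq_iff by (simp add: add.assoc)
  then show ?thesis
    using assms(2,3) by simp
qed

text \<open>
  With rows and columns numbered from 0, the \<open>l\<close>-th map is \<open>i \<mapsto> i + l\<close> modulo the number of
  columns. It is injective because there are no more rows than columns, and two different
  shifts \<open>l\<close> below the number of columns disagree at every row.
\<close>

lemma ex_cyclic_shifts:
  assumes "CARD('n::finite) \<le> CARD('m::finite)"
  obtains f :: "nat \<Rightarrow> 'n::finite \<Rightarrow> 'm::finite"
  where "\<And>l. inj (f l)" "\<And>i. inj_on (\<lambda>l. f l i) {..<CARD('m)}"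
proof -
  obtain g :: "'n \<Rightarrow> nat" where g: "bij_betw g UNIV {0..<CARD('n)}"
    using ex_bij_betw_finite_nat[of "UNIV :: 'n set"] by auto
  obtain h :: "nat \<Rightarrow> 'm" where h: "bij_betw h {0..<CARD('m)} UNIV"
    using ex_bij_betw_nat_finite[of "UNIV :: 'm set"] by auto
  define f where "f l i = h ((g i + l) mod CARD('m))" for l i
  have h_eq: "h (a mod CARD('m)) = h (b mod CARD('m)) \<longleftrightarrow> a mod CARD('m) = b mod CARD('m)" for a b
    using inj_on_eq_iff[OF bij_betw_imp_inj_on[OF h]] by simp
  have g_less: "g i < CARD('m)" for i
    using bij_betwE[OF g] assms by (meson UNIV_I atLeastLessThan_iff less_le_trans)
  have "inj (f l)" for l
  proof (rule injI)
    fix i i'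
    assume "f l i = f l i'"
    then have "g i = g i'"
      using g_less mod_add_left_inj[of l "g i" "CARD('m)" "g i'"]
      by (simp add: f_def h_eq add.commute)
    then show "i = i'"
      using bij_betw_imp_inj_on[OF g] by (simp add: inj_eq)
  qed
  moreover have "inj_on (\<lambda>l. f l i) {..<CARD('m)}" for i
    by (rule inj_onI) (auto simp: f_def h_eq intro: mod_add_left_inj)
  ultimately show thesis
    by (rule that)
qed

context
  fixes f :: "nat \<Rightarrow> 'n::finite \<Rightarrow> 'm::finite"
  assumes inj: "\<And>l. inj (f l)" and disj: "\<And>i. inj_on (\<lambda>l. f l i) {..<CARD('m)}"
begin

lemma matching_row_card:
  assumes "r \<le> CARD('m)"
  shows "card {j. (i, j) \<in> matching_union f r} = r"
proof -
  have "{j. (i, j) \<in> matching_union f r} = (\<lambda>l. f l i) ` {..<r}"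
    by (auto simp: matching_union_def)
  moreover have "inj_on (\<lambda>l. f l i) {..<r}"
    using assms by (intro inj_on_subset[OF disj]) auto
  ultimately show ?thesis
    by (simp add: card_image)
qed

lemma card_matching_union:
  assumes "r \<le> CARD('m)"
  shows "card (matching_union f r) = r * CARD('n)"
  using matching_row_card[OF assms] by (simp add: card_eq_sum_rows)

lemma disjoint_matchings:
  assumes "l < CARD('m)" "l' < CARD('m)" "l \<noteq> l'"
  shows "range (\<lambda>i. (i, f l i)) \<inter> range (\<lambda>i. (i, f l' i)) = {}"
  using disj assms by (auto dest: inj_onD)

lemma full_rank_matching_union: "0 < r \<Longrightarrow> full_rank (matching_union f r)"
  by (rule full_rank_mono[OF full_rank_matching[OF inj[of 0]]]) (auto simp: matching_union_def)

text \<open>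
  Deleting \<open>k\<close> edges cannot hit all of the \<open>k + 1\<close> disjoint matchings, while each left-node has
  only \<open>k + 1\<close> edges to lose.
\<close>

lemma resilient_matching_union:
  assumes "k < CARD('m)"
  shows "resilient k (pattern_of (matching_union f (k + 1)))"
proof -
  let ?E = "matching_union f (k + 1)"
  let ?M = "\<lambda>l. range (\<lambda>i. (i, f l i))"
  have "full_rank E'" if "E' \<subset> ?E" "card ?E \<le> card E' + k" for E'
  proof (rule ccontr)
    assume no: "\<not> full_rank E'"
    \<comment> \<open>Otherwise each of the \<open>k + 1\<close> disjoint matchings lost an edge.\<close>
    have "\<exists>e. e \<in> ?M l - E'" for l
      using no full_rank_mono[OF full_rank_matching[OF inj[of l]]] by blast
    then obtain e where e: "\<And>l. e l \<in> ?M l - E'"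
      by metis
    have "inj_on e {..<k + 1}"
    proof (rule inj_onI)
      fix l l'
      assume "l \<in> {..<k + 1}" "l' \<in> {..<k + 1}" "e l = e l'"
      then show "l = l'"
        using e[of l] e[of l'] disjoint_matchings[of l l'] assms by fastforce
    qed
    then have "card (e ` {..<k + 1}) = k + 1"
      by (simp add: card_image)
    moreover have "e ` {..<k + 1} \<subseteq> ?E - E'"
      using e unfolding matching_union_def by blast
    then have "card (e ` {..<k + 1}) \<le> card (?E - E')"
      by (intro card_mono) auto
    moreover have "card (?E - E') = card ?E - card E'"
      using that(1) by (intro card_Diff_subset) auto
    ultimately show False
      using that(2) by linarith
  qed
  moreover have "\<exists>E'. E' \<subset> ?E \<and> card E' + k + 1 = card ?E \<and> \<not> full_rank E'"
  proof -
    \<comment> \<open>Isolating one left-node, no matter which, takes exactly \<open>k + 1\<close> deletions.\<close>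
    fix i :: 'n
    let ?R = "{i} \<times> {j. (i, j) \<in> ?E}"
    have card: "card ?R = k + 1"
      using matching_row_card[of "k + 1" i] assms by (simp add: card_cartesian_product)
    have sub: "?R \<subseteq> ?E"
      by auto
    have "\<not> full_rank (?E - ?R)"
      using full_rank_row_nonempty[of "?E - ?R" i] by blast
    moreover have "card (?E - ?R) + k + 1 = card ?E"
      using card_Diff_subset[of ?R ?E] card_mono[of ?E ?R] card sub by simp
    moreover from this have "?E - ?R \<subset> ?E"
      by (metis Diff_subset add.assoc add_eq_self_zero add_is_0 one_neq_zero psubsetI)
    ultimately show ?thesis
      by blast
  qed
  moreover have "k \<le> card ?E"
    using card_matching_union[of "k + 1"] assms by (simp add: trans_le_add2)
  ultimately show ?thesis
    unfolding resilient_pattern_of_iff using full_rank_matching_union by simp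
qed

text \<open>
  The matchings themselves are the summands, since a matching with \<open>n\<close> edges is minimal for full
  rank; one summand more would need more edges than there are.
\<close>

lemma strongly_resilient_matching_union:
  assumes "k < CARD('m)"
  shows "strongly_resilient k (pattern_of (matching_union f (k + 1)))"
proof -
  let ?E = "matching_union f (k + 1)"
  let ?M = "\<lambda>l. range (\<lambda>i. (i, f l i))"
  have res: "resilient 0 (pattern_of (?M l))" for l
  proof -
    have card: "card (?M l) = CARD('n)"
      by (intro card_image injI) simp
    have less: "\<not> full_rank E'" if "E' \<subset> ?M l" for E'
      using full_rank_card_ge[of E'] psubset_card_mono[OF _ that] card by auto
    show ?thesis
      using full_rank_matching[OF inj[of l]] less by (rule resilient_0_if_minimal)
  qed
  have "contains_direct_sum (k + 1) (pattern_of ?E)"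
    unfolding contains_direct_sum_def
  proof (intro exI[of _ "\<lambda>l. pattern_of (?M l)"] conjI)
    show "disjoint_family_on (\<lambda>l. pattern_index (pattern_of (?M l))) {..<k + 1}"
      unfolding disjoint_family_on_def pattern_index_pattern_of
      using disjoint_matchings assms by simp
    show "span (\<Union>l<k + 1. pattern_of (?M l)) \<subseteq> pattern_of ?E"
      unfolding matching_union_def
      by (intro span_minimal subspace_pattern_of UN_least pattern_of_mono) blast
  qed (use res in auto)
  moreover have "\<not> contains_direct_sum (k + 2) (pattern_of ?E)"
    using contains_direct_sum_card_ge[of "k + 2" ?E] card_matching_union[of "k + 1"] assms
    by auto
  ultimately show ?thesis
    unfolding strongly_resilient_pattern_of_iff using full_rank_matching_union by simp
qed

end

section \<open>Bipartite graphs\<close>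

definition edge_pairs :: "('n::finite + 'm::finite) set set \<Rightarrow> ('n \<times> 'm) set" where
  "edge_pairs G = {(i, j). {Inl i, Inr j} \<in> G}"

definition graph_of :: "('n::finite \<times> 'm::finite) set \<Rightarrow> ('n + 'm) set set" where
  "graph_of E = (\<lambda>(i, j). {Inl i, Inr j}) ` E"

lemma graph_pattern_eq: "graph_pattern G = pattern_of (edge_pairs G)"
  by (simp add: graph_pattern_def pattern_of_def edge_pairs_def)

lemma bipartite_graph_of: "bipartite_graph (graph_of E)"
  by (auto simp: bipartite_graph_def graph_of_def)

lemma edge_pairs_graph_of [simp]: "edge_pairs (graph_of E) = E"
  by (auto simp: edge_pairs_def graph_of_def doubleton_eq_iff image_iff)

lemma card_graph_of: "card (graph_of E) = card E"
  unfolding graph_of_def by (intro card_image inj_onI) (auto simp: doubleton_eq_iff)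

lemma graph_of_edge_pairs: "bipartite_graph G \<Longrightarrow> graph_of (edge_pairs G) = G"
  by (auto simp: bipartite_graph_def graph_of_def edge_pairs_def image_iff)

lemma graph_pattern_graph_of [simp]: "graph_pattern (graph_of E) = pattern_of E"
  by (simp add: graph_pattern_eq)

text \<open>
  The next two lemmas carry extremal statements about index sets over to graphs, for any
  property or degree that depends on the pattern only.
\<close>

lemma is_minimum_card_bipartite_graphI:
  assumes "card E = c" "P (pattern_of E)" "\<And>E. P (pattern_of E) \<Longrightarrow> c \<le> card E"
  shows "is_minimum c {card G |G. bipartite_graph G \<and> P (graph_pattern G)}"
proof -
  have "c \<in> {card G |G. bipartite_graph G \<and> P (graph_pattern G)}"
    using assms(1,2) bipartite_graph_of[of E] card_graph_of[of E]
    by (intro CollectI exI[of _ "graph_of E"]) simp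
  moreover have "c \<le> card G" if "bipartite_graph G" "P (graph_pattern G)" for G
    using assms(3)[of "edge_pairs G"] that
    by (metis card_graph_of graph_of_edge_pairs graph_pattern_eq)
  ultimately show ?thesis
    unfolding is_minimum_def by blast
qed

lemma is_maximum_bipartite_graphI:
  assumes "d (pattern_of E) = c" "\<And>E. d (pattern_of E) \<le> c"
  shows "is_maximum c {d (graph_pattern G) |G. bipartite_graph G}"
proof -
  have "c \<in> {d (graph_pattern G) |G. bipartite_graph G}"
    using assms(1) bipartite_graph_of[of E]
    by (intro CollectI exI[of _ "graph_of E"]) simp
  moreover have "d (graph_pattern G) \<le> c" for G
    by (simp add: graph_pattern_eq assms(2))
  ultimately show ?thesis
    unfolding is_maximum_def by blast
qed

theorem corollary2:
  assumes "CARD('n::finite) \<le> CARD('m::finite)"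
  shows "(\<forall>k\<in>{1..CARD('m) - 1}.
            is_minimum ((k + 1) * CARD('n))
              {card G |G :: ('n + 'm) set set. bipartite_graph G \<and> graph_resilient k G} \<and>
            is_minimum ((k + 1) * CARD('n))
              {card G |G :: ('n + 'm) set set. bipartite_graph G \<and> graph_strongly_resilient k G})
       \<and> is_maximum (int CARD('m) - 1)
            {graph_resilience_degree G |G :: ('n + 'm) set set. bipartite_graph G}
       \<and> is_maximum (int CARD('m) - 1)
            {graph_strong_resilience_degree G |G :: ('n + 'm) set set. bipartite_graph G}"
proof -
  obtain f :: "nat \<Rightarrow> 'n \<Rightarrow> 'm"
    where f: "\<And>l. inj (f l)" "\<And>i. inj_on (\<lambda>l. f l i) {..<CARD('m)}"
    using ex_cyclic_shifts[OF assms] by blast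
  note graph_notions = graph_resilient_def graph_strongly_resilient_def
    graph_resilience_degree_def graph_strong_resilience_degree_def
  have min: "is_minimum ((k + 1) * CARD('n))
        {card G |G :: ('n + 'm) set set. bipartite_graph G \<and> graph_resilient k G}"
      "is_minimum ((k + 1) * CARD('n))
        {card G |G :: ('n + 'm) set set. bipartite_graph G \<and> graph_strongly_resilient k G}"
    if k: "k < CARD('m)" for k
  proof -
    have card: "card (matching_union f (k + 1)) = (k + 1) * CARD('n)"
      using k by (intro card_matching_union[OF f]) simp
    have "(k + 1) * CARD('n) \<le> card E" if "strongly_resilient k (pattern_of E)"
      for E :: "('n \<times> 'm) set"
      using that contains_direct_sum_card_ge strongly_resilient_pattern_of_iff by blast
    then show "is_minimum ((k + 1) * CARD('n))
        {card G |G :: ('n + 'm) set set. bipartite_graph G \<and> graph_resilient k G}"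
      "is_minimum ((k + 1) * CARD('n))
        {card G |G :: ('n + 'm) set set. bipartite_graph G \<and> graph_strongly_resilient k G}"
      unfolding graph_notions
      using card resilient_card_ge resilient_matching_union[OF f k]
        strongly_resilient_matching_union[OF f k]
      by (blast intro: is_minimum_card_bipartite_graphI)+
  qed
  let ?k = "CARD('m) - 1"
  have k: "?k < CARD('m)" "int ?k = int CARD('m) - 1"
    by (auto simp: of_nat_diff Suc_le_eq)
  have max: "is_maximum (int CARD('m) - 1)
      {graph_resilience_degree G |G :: ('n + 'm) set set. bipartite_graph G}"
    unfolding graph_notions
    using resilience_degree_eq[OF resilient_matching_union[OF f k(1)]] k(2) resilience_degree_le
    by (intro is_maximum_bipartite_graphI) simp_all
  have strong_max: "is_maximum (int CARD('m) - 1)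
      {graph_strong_resilience_degree G |G :: ('n + 'm) set set. bipartite_graph G}"
    unfolding graph_notions
    using strong_resilience_degree_eq[OF strongly_resilient_matching_union[OF f k(1)]] k(2)
      strong_resilience_degree_le
    by (intro is_maximum_bipartite_graphI) simp_all
  have "k < CARD('m)" if "k \<in> {1..CARD('m) - 1}" for k
    using that by auto
  then show ?thesis
    using min max strong_max by blast
qed

end
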